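(* Let $h:\mathbb{R}^d\times\mathbb{N}^p\to\mathbb{R}$ be a measurable function which is either nonnegative or such that $\mathbb{E}[|h(G,N^\mu)|]<\infty$. Then for all $\theta\in\mathbb{R}^d$ and all $\lambda\in(0,\infty)^p$, $$\mathbb{E}[h(G,N^\mu)]=\mathbb{E}\left[h(G+\theta,N^\lambda)\,e^{-\theta\cdot G-\frac{|\theta|^2}{2}}\prod_{i=1}^p e^{\lambda_i-\mu_i}\left(\frac{\mu_i}{\lambda_i}\right)^{N_i^{\lambda_i}}\right].$$
   Context: $\mathbb{N}=\{0,1,2,\dots\}$. $G=(G_1,\dots,G_d)$ is a standard normal random vector in $\mathbb{R}^d$. For $\lambda=(\lambda_1,\dots,\lambda_p)\in(0,\infty)^p$, $N^\lambda=(N_1^{\lambda_1},\dots,N_p^{\lambda_p})$ denotes a vector of $p$ independent Poisson random variables with parameters $\lambda_1,\dots,\lambda_p$, independent of $G$. The vector $\mu=(\mu_1,\dots,\mu_p)\in(0,\infty)^p$ is fixed, and $N^\mu$ is the corresponding vector for $\lambda=\mu$. $|\cdot|$ is the Euclidean norm and $\cdot$ the scalar product. *)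

theory Defs
  imports "HOL-Probability.Probability"
begin

(* prob_space.indep_var requires both variables to have values in the same type.
   This is the same notion (independence of the generated sigma-algebras) for variables
   with values in different types. *)
definition indep_rv ::
  "'w measure \<Rightarrow> 'b measure \<Rightarrow> ('w \<Rightarrow> 'b) \<Rightarrow> 'c measure \<Rightarrow> ('w \<Rightarrow> 'c) \<Rightarrow> bool" where
  "indep_rv M S X T Y \<longleftrightarrow>
     X \<in> measurable M S \<and> Y \<in> measurable M T \<and>
     prob_space.indep_set M {X -` A \<inter> space M |A. A \<in> sets S} {Y -` B \<inter> space M |B. B \<in> sets T}"

definition std_normal_vector :: "'w measure \<Rightarrow> ('w \<Rightarrow> real ^ 'd) \<Rightarrow> bool" where
  "std_normal_vector M G \<longleftrightarrow>
     prob_space.indep_vars M (\<lambda>_. borel) (\<lambda>j \<omega>. G \<omega> $ j) UNIV \<and>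
     (\<forall>j. distributed M lborel (\<lambda>\<omega>. G \<omega> $ j) std_normal_density)"

definition poisson_vector :: "'w measure \<Rightarrow> real ^ 'p \<Rightarrow> ('w \<Rightarrow> nat ^ 'p) \<Rightarrow> bool" where
  "poisson_vector M lam N \<longleftrightarrow>
     prob_space.indep_vars M (\<lambda>_. count_space UNIV) (\<lambda>i \<omega>. N \<omega> $ i) UNIV \<and>
     (\<forall>i. distr M (count_space UNIV) (\<lambda>\<omega>. N \<omega> $ i) = measure_pmf (poisson_pmf (lam $ i)))"

(* N is a version of N^lam: only its joint law with G is prescribed. In particular nothing is
   required of the joint law of two such vectors with different parameters. *)
definition poisson_vector_indep ::
  "'w measure \<Rightarrow> ('w \<Rightarrow> real ^ 'd) \<Rightarrow> real ^ 'p \<Rightarrow> ('w \<Rightarrow> nat ^ 'p) \<Rightarrow> bool" where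
  "poisson_vector_indep M G lam N \<longleftrightarrow>
     poisson_vector M lam N \<and> indep_rv M borel G (count_space UNIV) N"

definition girsanov_weight ::
  "real ^ 'd \<Rightarrow> real ^ 'p \<Rightarrow> real ^ 'p \<Rightarrow> real ^ 'd \<Rightarrow> nat ^ 'p \<Rightarrow> real" where
  "girsanov_weight \<theta> mu lam g n =
     exp (- (\<theta> \<bullet> g) - (norm \<theta>)\<^sup>2 / 2) *
     (\<Prod>i\<in>UNIV. exp (lam $ i - mu $ i) * (mu $ i / lam $ i) ^ (n $ i))"

end

theory Submission
  imports Defs
begin

text \<open>
  The identity is a change of measure that factorizes over the coordinates. In dimension one it is
  a statement about two explicit laws: the standard normal law is the image under \<open>x \<mapsto> x + t\<close> of
  its own reweighting by \<open>exp (- t x - t\<^sup>2 / 2)\<close>, and the Poisson law of parameter \<open>m\<close> has density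
  \<open>exp (l - m) (m / l) ^ n\<close> with respect to the Poisson law of parameter \<open>l\<close>.

  Both facts have the form ``\<open>B\<close> is the image under \<open>T\<close> of \<open>A\<close> reweighted by \<open>u\<close>'', and this
  relation passes to products, with the product of the weights and the coordinatewise map
  (\<open>PiM_eq_distr_density\<close>). Independence of the coordinates therefore lifts the one-dimensional
  facts to the laws of the two random vectors (\<open>distr_vec_change_of_measure\<close>), and independence of
  the Gaussian and the Poisson vector lifts them once more to the joint law
  (\<open>distr_pair_change_of_measure\<close>): the law of \<open>(G, N\<^sup>\<mu>)\<close> is the image under \<open>(G + \<theta>, N\<^sup>\<lambda>)\<close> of the
  underlying probability, reweighted by the Girsanov weight. Integrating \<open>h\<close> against this equality
  of measures gives the nonnegative and the integrable case alike.
\<close>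

section \<open>Change of measure and product measures\<close>

text \<open>
  It suffices to compare the two measures on boxes. There the integrand on the right is a product
  of functions of one coordinate each, so that the integral is the product of the one-dimensional
  ones.
\<close>

lemma PiM_eq_distr_density:
  fixes A B :: "'i \<Rightarrow> 'b measure" and u :: "'i \<Rightarrow> 'b \<Rightarrow> ennreal"
  assumes "finite I"
    and A: "\<And>i. prob_space (A i)" and B: "\<And>i. prob_space (B i)"
    and u: "\<And>i. u i \<in> borel_measurable (A i)" and T: "\<And>i. T i \<in> measurable (A i) (B i)"
    and eq: "\<And>i. B i = distr (density (A i) (u i)) (B i) (T i)"
  shows "PiM I B = distr (density (PiM I A) (\<lambda>x. \<Prod>i\<in>I. u i (x i))) (PiM I B)
    (\<lambda>x. \<lambda>i\<in>I. T i (x i))"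
proof -
  interpret A: product_sigma_finite A
    by (simp add: product_sigma_finite_def A prob_space_imp_sigma_finite)
  interpret B: product_sigma_finite B
    by (simp add: product_sigma_finite_def B prob_space_imp_sigma_finite)
  note u[measurable] T[measurable]
  let ?w = "\<lambda>x. \<Prod>i\<in>I. u i (x i)"
  let ?T = "\<lambda>x. \<lambda>i\<in>I. T i (x i)"
  have [measurable]: "?T \<in> measurable (PiM I A) (PiM I B)"
    by (rule measurable_restrict) measurable
  have w[measurable]: "?w \<in> borel_measurable (PiM I A)"
    by (intro borel_measurable_prod_ennreal) measurable
  show ?thesis
  proof (rule B.PiM_eqI[symmetric])
    show "finite I" by fact
    show "sets (distr (density (PiM I A) ?w) (PiM I B) ?T) = sets (PiM I B)"
      by simp
  next
    fix C assume C: "\<And>i. i \<in> I \<Longrightarrow> C i \<in> sets (B i)"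
    have box[measurable]: "Pi\<^sub>E I C \<in> sets (PiM I B)"
      using C \<open>finite I\<close> by (intro sets_PiM_I_finite)
    have "emeasure (distr (density (PiM I A) ?w) (PiM I B) ?T) (Pi\<^sub>E I C) =
        (\<integral>\<^sup>+x. ?w x * indicator (?T -` Pi\<^sub>E I C \<inter> space (PiM I A)) x \<partial>PiM I A)"
      by (simp add: emeasure_distr emeasure_density)
    also have "\<dots> = (\<integral>\<^sup>+x. (\<Prod>i\<in>I. u i (x i) * indicator (C i) (T i (x i))) \<partial>PiM I A)"
    proof (rule nn_integral_cong)
      fix x assume "x \<in> space (PiM I A)"
      moreover have "indicator (Pi\<^sub>E I C) (?T x) = (\<Prod>i\<in>I. indicator (C i) (T i (x i)) :: ennreal)"
        using \<open>finite I\<close> by (auto simp: indicator_def PiE_iff)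
      ultimately show "?w x * indicator (?T -` Pi\<^sub>E I C \<inter> space (PiM I A)) x =
          (\<Prod>i\<in>I. u i (x i) * indicator (C i) (T i (x i)))"
        by (simp add: prod.distrib indicator_def)
    qed
    also have "\<dots> = (\<Prod>i\<in>I. \<integral>\<^sup>+y. u i y * indicator (C i) (T i y) \<partial>A i)"
    proof (rule A.product_nn_integral_prod[OF \<open>finite I\<close>])
      fix i assume "i \<in> I"
      then have [measurable]: "C i \<in> sets (B i)" by (rule C)
      show "(\<lambda>y. u i y * indicator (C i) (T i y)) \<in> borel_measurable (A i)" by measurable
    qed
    also have "\<dots> = (\<Prod>i\<in>I. emeasure (B i) (C i))"
    proof (rule prod.cong[OF refl])
      fix i assume "i \<in> I"
      then have [measurable]: "C i \<in> sets (B i)" by (rule C)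
      have "emeasure (B i) (C i) = emeasure (distr (density (A i) (u i)) (B i) (T i)) (C i)"
        using eq[of i] by simp
      also have "\<dots> = (\<integral>\<^sup>+y. u i y * indicator (T i -` C i \<inter> space (A i)) y \<partial>A i)"
        by (simp add: emeasure_distr emeasure_density)
      also have "\<dots> = (\<integral>\<^sup>+y. u i y * indicator (C i) (T i y) \<partial>A i)"
        by (intro nn_integral_cong) (simp add: indicator_def)
      finally show "(\<integral>\<^sup>+y. u i y * indicator (C i) (T i y) \<partial>A i) = emeasure (B i) (C i)" ..
    qed
    finally show "emeasure (distr (density (PiM I A) ?w) (PiM I B) ?T) (Pi\<^sub>E I C) =
        (\<Prod>i\<in>I. emeasure (B i) (C i))" .
  qed
qed

text \<open>
  The \<open>\<sigma>\<close>-algebra \<open>S\<close> on vectors is a parameter, since it is the Borel one for Gaussian vectors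
  and the discrete one for Poisson vectors; the two measurability assumptions identify it with the
  product \<open>\<sigma>\<close>-algebra.
\<close>

lemma distr_vec_change_of_measure:
  fixes X Y :: "'w \<Rightarrow> 'b ^ 'n" and u :: "'n \<Rightarrow> 'b \<Rightarrow> ennreal"
  assumes M: "prob_space M"
    and X: "prob_space.indep_vars M (\<lambda>_. N) (\<lambda>i \<omega>. X \<omega> $ i) UNIV"
    and Y: "prob_space.indep_vars M (\<lambda>_. N) (\<lambda>i \<omega>. Y \<omega> $ i) UNIV"
    and u[measurable]: "\<And>i. u i \<in> borel_measurable N"
    and T[measurable]: "\<And>i. T i \<in> measurable N N"
    and eq: "\<And>i. distr M N (\<lambda>\<omega>. X \<omega> $ i) = distr (density (distr M N (\<lambda>\<omega>. Y \<omega> $ i)) (u i)) N (T i)"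
    and vec[measurable]: "vec_lambda \<in> measurable (PiM UNIV (\<lambda>_. N)) S"
    and nth[measurable]: "\<And>i. (\<lambda>y. y $ i) \<in> measurable S N"
  shows "distr M S X =
    distr (density (distr M S Y) (\<lambda>y. \<Prod>i\<in>UNIV. u i (y $ i))) S (\<lambda>y. \<chi> i. T i (y $ i))"
proof -
  interpret prob_space M by fact
  have law: "distr M S Z = distr (PiM UNIV (\<lambda>i. distr M N (\<lambda>\<omega>. Z \<omega> $ i))) S vec_lambda"
    if Z: "indep_vars (\<lambda>_. N) (\<lambda>i \<omega>. Z \<omega> $ i) UNIV" for Z :: "'w \<Rightarrow> 'b ^ 'n"
  proof -
    have rv[measurable]: "random_variable N (\<lambda>\<omega>. Z \<omega> $ i)" for i
      using Z by (simp add: indep_vars_def2)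
    have joint: "PiM UNIV (\<lambda>i. distr M N (\<lambda>\<omega>. Z \<omega> $ i)) =
        distr M (PiM UNIV (\<lambda>_. N)) (\<lambda>\<omega>. \<lambda>i\<in>UNIV. Z \<omega> $ i)"
      using Z by (subst (asm) indep_vars_iff_distr_eq_PiM) simp_all
    have "(\<lambda>\<omega>. \<lambda>i\<in>UNIV. Z \<omega> $ i) \<in> measurable M (PiM UNIV (\<lambda>_. N))"
      by (rule measurable_restrict) (rule rv)
    then show ?thesis
      unfolding joint by (subst distr_distr[OF vec]) (simp_all add: comp_def restrict_def)
  qed
  let ?A = "\<lambda>i. distr M N (\<lambda>\<omega>. Y \<omega> $ i)" and ?B = "\<lambda>i. distr M N (\<lambda>\<omega>. X \<omega> $ i)"
  let ?w = "\<lambda>y. \<Prod>i\<in>UNIV. u i (y i)"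
  have rv[measurable]: "random_variable N (\<lambda>\<omega>. X \<omega> $ i)" "random_variable N (\<lambda>\<omega>. Y \<omega> $ i)" for i
    using X Y by (simp_all add: indep_vars_def2)
  have setsA[measurable_cong]: "sets (PiM UNIV ?A) = sets (PiM UNIV (\<lambda>_. N))"
    and setsB[measurable_cong]: "sets (PiM UNIV ?B) = sets (PiM UNIV (\<lambda>_. N))"
    by (simp_all cong: sets_PiM_cong)
  have coordinatewise: "(\<lambda>y i. F i y) \<in> measurable K (PiM UNIV (\<lambda>_. N))"
    if "\<And>i. F i \<in> measurable K N" for F :: "'n \<Rightarrow> 'c \<Rightarrow> 'b" and K
    using measurable_restrict[of UNIV F K "\<lambda>_. N"] that by (simp add: restrict_def)
  have [measurable]: "(\<lambda>y i. T i (y i)) \<in> measurable (PiM UNIV (\<lambda>_. N)) (PiM UNIV (\<lambda>_. N))"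
    by (rule coordinatewise) measurable
  have "(\<lambda>y i. T i (y $ i)) \<in> measurable S (PiM UNIV (\<lambda>_. N))"
    by (rule coordinatewise) measurable
  from measurable_compose[OF this vec]
  have [measurable]: "(\<lambda>y. \<chi> i. T i (y $ i)) \<in> measurable S S" .
  have [measurable]: "(\<lambda>y. \<Prod>i\<in>UNIV. u i (y $ i)) \<in> borel_measurable S"
    by (intro borel_measurable_prod_ennreal) measurable
  have unrestrict: "(\<lambda>y i. T i (y i)) = (\<lambda>y. \<lambda>i\<in>UNIV. T i (y i))"
    by (simp add: restrict_def)
  have product: "PiM UNIV ?B = distr (density (PiM UNIV ?A) ?w) (PiM UNIV ?B) (\<lambda>y i. T i (y i))"
    unfolding unrestrict
  proof (rule PiM_eq_distr_density)
    show "?B i = distr (density (?A i) (u i)) (?B i) (T i)" for i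
      using eq[of i] by (simp cong: distr_cong)
  qed (auto intro!: prob_space_distr rv)
  have "distr M S X = distr (PiM UNIV ?B) S vec_lambda"
    by (rule law[OF X])
  also have "\<dots> =
      distr (distr (density (PiM UNIV ?A) ?w) (PiM UNIV ?B) (\<lambda>y i. T i (y i))) S vec_lambda"
    by (rule arg_cong[OF product])
  also have "\<dots> = distr (density (PiM UNIV ?A) ?w) S (\<lambda>y. \<chi> i. T i (y i))"
    by (subst distr_distr) (simp_all add: comp_def)
  also have "\<dots> = distr (distr (density (PiM UNIV ?A) (\<lambda>y. \<Prod>i\<in>UNIV. u i (vec_lambda y $ i)))
      S vec_lambda) S (\<lambda>y. \<chi> i. T i (y $ i))"
    by (subst distr_distr) (simp_all add: comp_def)
  also have "\<dots> = distr (density (distr M S Y) (\<lambda>y. \<Prod>i\<in>UNIV. u i (y $ i))) S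
      (\<lambda>y. \<chi> i. T i (y $ i))"
    by (subst law[OF Y], subst density_distr) simp_all
  finally show ?thesis .
qed

lemma indep_rv_imp_distr_Pair:
  assumes M: "prob_space M" and ind: "indep_rv M S X T Y"
  shows "distr M (S \<Otimes>\<^sub>M T) (\<lambda>\<omega>. (X \<omega>, Y \<omega>)) = distr M S X \<Otimes>\<^sub>M distr M T Y"
proof -
  interpret prob_space M by fact
  have [measurable]: "X \<in> measurable M S" "Y \<in> measurable M T"
    using ind by (auto simp: indep_rv_def)
  show ?thesis
  proof (rule pair_measure_eqI[symmetric])
    fix A B assume "A \<in> sets (distr M S X)" "B \<in> sets (distr M T Y)"
    then have [measurable]: "A \<in> sets S" "B \<in> sets T" by auto
    have "prob ((X -` A \<inter> space M) \<inter> (Y -` B \<inter> space M)) =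
        prob (X -` A \<inter> space M) * prob (Y -` B \<inter> space M)"
      using ind by (intro indep_setD[where A = "{X -` A \<inter> space M |A. A \<in> sets S}"
          and B = "{Y -` B \<inter> space M |B. B \<in> sets T}"]) (auto simp: indep_rv_def)
    moreover have "(\<lambda>\<omega>. (X \<omega>, Y \<omega>)) -` (A \<times> B) \<inter> space M =
        (X -` A \<inter> space M) \<inter> (Y -` B \<inter> space M)" by auto
    ultimately show "emeasure (distr M S X) A * emeasure (distr M T Y) B =
        emeasure (distr M (S \<Otimes>\<^sub>M T) (\<lambda>\<omega>. (X \<omega>, Y \<omega>))) (A \<times> B)"
      by (simp add: emeasure_distr emeasure_eq_measure ennreal_mult'')
  qed (auto intro!: prob_space_imp_sigma_finite prob_space_distr sets_pair_measure_cong)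
qed

text \<open>
  The conclusion is stated on \<open>M\<close> itself and not on the product space, so that integrating a
  function against it directly yields expectations of \<open>(f (X \<omega>), g (Y \<omega>))\<close> with a weight.
\<close>

lemma distr_pair_change_of_measure:
  fixes u :: "'b \<Rightarrow> ennreal" and v :: "'c \<Rightarrow> ennreal"
  assumes M: "prob_space M"
    and ind': "indep_rv M S X' T Y'" and ind: "indep_rv M S X T Y"
    and [measurable]: "u \<in> borel_measurable S" "v \<in> borel_measurable T"
    and [measurable]: "f \<in> measurable S S" "g \<in> measurable T T"
    and eqX: "distr M S X' = distr (density (distr M S X) u) S f"
    and eqY: "distr M T Y' = distr (density (distr M T Y) v) T g"
  shows "distr M (S \<Otimes>\<^sub>M T) (\<lambda>\<omega>. (X' \<omega>, Y' \<omega>)) =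
    distr (density M (\<lambda>\<omega>. u (X \<omega>) * v (Y \<omega>))) (S \<Otimes>\<^sub>M T) (\<lambda>\<omega>. (f (X \<omega>), g (Y \<omega>)))"
proof -
  interpret prob_space M by fact
  have [measurable]: "X \<in> measurable M S" "Y \<in> measurable M T"
      "X' \<in> measurable M S" "Y' \<in> measurable M T"
    using ind ind' by (auto simp: indep_rv_def)
  have sf': "sigma_finite_measure (distr (density (distr M T Y) v) T g)"
    unfolding eqY[symmetric] by (intro prob_space_imp_sigma_finite prob_space_distr) measurable
  have sf: "sigma_finite_measure (distr M T Y)"
    by (intro prob_space_imp_sigma_finite prob_space_distr) measurable
  \<comment> \<open>Products of densities require \<open>\<sigma>\<close>-finiteness of the reweighted law. Its total mass is that of
    its image under \<open>g\<close>, which is the law of \<open>Y'\<close>.\<close>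
  have "finite_measure (density (distr M T Y) v)"
  proof
    have "g -` space T \<inter> space T = space T"
      using measurable_space[OF \<open>g \<in> measurable T T\<close>] by auto
    then have "emeasure (distr M T Y') (space T) = emeasure (density (distr M T Y) v) (space T)"
      by (subst eqY, subst emeasure_distr) simp_all
    moreover have "emeasure (distr M T Y') (space T) \<noteq> \<infinity>"
      by (simp add: emeasure_distr)
    ultimately show "emeasure (density (distr M T Y) v) (space (density (distr M T Y) v)) \<noteq> \<infinity>"
      by simp
  qed
  then have sfd: "sigma_finite_measure (density (distr M T Y) v)"
    by (rule finite_measure.axioms)
  have "distr M (S \<Otimes>\<^sub>M T) (\<lambda>\<omega>. (X' \<omega>, Y' \<omega>)) =
      distr (density (distr M S X) u) S f \<Otimes>\<^sub>M distr (density (distr M T Y) v) T g"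
    by (simp add: indep_rv_imp_distr_Pair[OF M ind'] eqX eqY)
  also have "\<dots> = distr (density (distr M S X) u \<Otimes>\<^sub>M density (distr M T Y) v) (S \<Otimes>\<^sub>M T)
      (\<lambda>(x, y). (f x, g y))"
    by (rule pair_measure_distr) (use sf' in simp_all)
  also have "density (distr M S X) u \<Otimes>\<^sub>M density (distr M T Y) v =
      density (distr M S X \<Otimes>\<^sub>M distr M T Y) (\<lambda>(x, y). u x * v y)"
    by (rule pair_measure_density) (use sf sfd in simp_all)
  also have "distr M S X \<Otimes>\<^sub>M distr M T Y = distr M (S \<Otimes>\<^sub>M T) (\<lambda>\<omega>. (X \<omega>, Y \<omega>))"
    by (rule indep_rv_imp_distr_Pair[OF M ind, symmetric])
  also have "density \<dots> (\<lambda>(x, y). u x * v y) =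
      distr (density M (\<lambda>\<omega>. u (X \<omega>) * v (Y \<omega>))) (S \<Otimes>\<^sub>M T) (\<lambda>\<omega>. (X \<omega>, Y \<omega>))"
    by (subst density_distr) simp_all
  also have "distr \<dots> (S \<Otimes>\<^sub>M T) (\<lambda>(x, y). (f x, g y)) =
      distr (density M (\<lambda>\<omega>. u (X \<omega>) * v (Y \<omega>))) (S \<Otimes>\<^sub>M T) (\<lambda>\<omega>. (f (X \<omega>), g (Y \<omega>)))"
    by (subst distr_distr) (simp_all add: comp_def)
  finally show ?thesis .
qed

section \<open>The Gaussian and the Poisson weights\<close>

text \<open>
  Completing the square shows that \<open>exp (- t x - t\<^sup>2 / 2)\<close> times the normal density at \<open>x\<close> is the
  normal density at \<open>x + t\<close>; the rest is translation invariance of Lebesgue measure.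
\<close>

lemma std_normal_distribution_shift:
  "density lborel std_normal_density =
    distr (density (density lborel std_normal_density) (\<lambda>x. ennreal (exp (- (t * x) - t\<^sup>2 / 2))))
      borel (\<lambda>x. x + t)"
proof -
  have dens: "std_normal_density (t + x) = std_normal_density x * exp (- (t * x) - t\<^sup>2 / 2)" for x
  proof -
    have "- ((t + x)\<^sup>2 / 2) = - (x\<^sup>2 / 2) + (- (t * x) - t\<^sup>2 / 2)"
      by (simp add: power2_eq_square field_simps)
    then show ?thesis
      by (simp add: normal_density_def mult_exp_exp)
  qed
  have "density lborel std_normal_density =
      density (distr lborel borel ((+) t)) (\<lambda>x. ennreal (std_normal_density x))"
    by (simp add: lborel_distr_plus)
  also have "\<dots> = distr (density lborel (\<lambda>x. ennreal (std_normal_density (t + x)))) borel ((+) t)"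
    by (rule density_distr) simp_all
  also have "density lborel (\<lambda>x. ennreal (std_normal_density (t + x))) =
      density (density lborel std_normal_density) (\<lambda>x. ennreal (exp (- (t * x) - t\<^sup>2 / 2)))"
    by (subst density_density_eq) (simp_all add: dens ennreal_mult'')
  also have "(+) t = (\<lambda>x. x + t)" by (simp add: fun_eq_iff)
  finally show ?thesis .
qed

text \<open>
  The factorials in the two probability mass functions cancel, so their quotient is the weight.
\<close>

lemma poisson_pmf_eq_density:
  assumes "0 < l" "0 < m"
  shows "measure_pmf (poisson_pmf m) =
    density (measure_pmf (poisson_pmf l)) (\<lambda>n. ennreal (exp (l - m) * (m / l) ^ n))"
proof -
  have "pmf (poisson_pmf m) n = pmf (poisson_pmf l) n * (exp (l - m) * (m / l) ^ n)" for n
  proof -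
    have "exp (- m) = exp (- l) * exp (l - m)" by (simp add: mult_exp_exp)
    with assms show ?thesis by (simp add: power_divide)
  qed
  then show ?thesis
    unfolding measure_pmf_eq_density
    by (subst density_density_eq) (simp_all add: ennreal_mult')
qed

lemma std_normal_vector_shift:
  fixes G :: "'w \<Rightarrow> real ^ 'd"
  assumes M: "prob_space M" and G: "std_normal_vector M G"
  shows "distr M borel G = distr (density (distr M borel G)
      (\<lambda>x. \<Prod>j\<in>UNIV. ennreal (exp (- (\<theta> $ j * x $ j) - (\<theta> $ j)\<^sup>2 / 2)))) borel (\<lambda>x. x + \<theta>)"
proof -
  have law: "distr M borel (\<lambda>\<omega>. G \<omega> $ j) = density lborel std_normal_density" for j
  proof -
    have "distributed M lborel (\<lambda>\<omega>. G \<omega> $ j) std_normal_density"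
      using G by (simp add: std_normal_vector_def)
    then have "distr M lborel (\<lambda>\<omega>. G \<omega> $ j) = density lborel std_normal_density"
      by (rule distributed_distr_eq_density)
    then show ?thesis by (simp cong: distr_cong)
  qed
  have "distr M borel G = distr (density (distr M borel G)
      (\<lambda>x. \<Prod>j\<in>UNIV. ennreal (exp (- (\<theta> $ j * x $ j) - (\<theta> $ j)\<^sup>2 / 2)))) borel
      (\<lambda>x. \<chi> j. x $ j + \<theta> $ j)"
  proof (rule distr_vec_change_of_measure[where N = borel])
    show "(vec_lambda :: ('d \<Rightarrow> real) \<Rightarrow> _) \<in> measurable (PiM UNIV (\<lambda>_. borel)) borel"
      by (subst borel_measurable_euclidean_space) (auto simp: Basis_vec_def inner_axis)
  qed (use M G std_normal_distribution_shift in
      \<open>simp_all add: std_normal_vector_def law borel_measurable_nth\<close>)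
  also have "(\<lambda>x. \<chi> j. x $ j + \<theta> $ j) = (\<lambda>x. x + \<theta>)"
    by (simp add: fun_eq_iff vec_eq_iff)
  finally show ?thesis .
qed

lemma poisson_vector_change_parameter:
  fixes lam mu :: "real ^ 'p"
  assumes M: "prob_space M"
    and pos: "\<And>i. 0 < lam $ i" "\<And>i. 0 < mu $ i"
    and "poisson_vector M mu Nmu" and "poisson_vector M lam Nlam"
  shows "distr M (count_space UNIV) Nmu = distr (density (distr M (count_space UNIV) Nlam)
      (\<lambda>n. \<Prod>i\<in>UNIV. ennreal (exp (lam $ i - mu $ i) * (mu $ i / lam $ i) ^ (n $ i))))
      (count_space UNIV) (\<lambda>n. n)"
proof -
  have vec: "vec_lambda \<in> measurable (PiM UNIV (\<lambda>_. count_space UNIV))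
      (count_space (UNIV :: (nat ^ 'p) set))"
  \<comment> \<open>There are countably many vectors, and the preimage of a single one is a box.\<close>
  proof (subst measurable_count_space_eq_countable, safe)
    fix n :: "nat ^ 'p"
    have "vec_lambda -` {n} = Pi\<^sub>E (UNIV :: 'p set) (\<lambda>i. {n $ i})"
      by (auto simp: vec_eq_iff PiE_iff)
    then show "vec_lambda -` {n} \<inter> space (PiM UNIV (\<lambda>_. count_space UNIV)) \<in>
        sets (PiM (UNIV :: 'p set) (\<lambda>_. count_space UNIV))"
      using sets_PiM_I_finite[of "UNIV :: 'p set" "\<lambda>i. {n $ i}" "\<lambda>_. count_space UNIV"]
      by (simp add: space_PiM)
  qed (simp_all add: space_PiM)
  have "distr M (count_space UNIV) Nmu = distr (density (distr M (count_space UNIV) Nlam)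
      (\<lambda>n. \<Prod>i\<in>UNIV. ennreal (exp (lam $ i - mu $ i) * (mu $ i / lam $ i) ^ (n $ i))))
      (count_space UNIV) (\<lambda>n. \<chi> i. n $ i)"
  proof (rule distr_vec_change_of_measure[OF M])
    fix i
    show "distr M (count_space UNIV) (\<lambda>\<omega>. Nmu \<omega> $ i) =
        distr (density (distr M (count_space UNIV) (\<lambda>\<omega>. Nlam \<omega> $ i))
          (\<lambda>n. ennreal (exp (lam $ i - mu $ i) * (mu $ i / lam $ i) ^ n))) (count_space UNIV) (\<lambda>n. n)"
      using assms poisson_pmf_eq_density[OF pos(1)[of i] pos(2)[of i]]
      by (simp add: poisson_vector_def distr_id2)
  qed (use assms vec in \<open>simp_all add: poisson_vector_def\<close>)
  then show ?thesis by simp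
qed

lemma girsanov_weight_eq_prod:
  "girsanov_weight \<theta> mu lam g n =
    (\<Prod>j\<in>UNIV. exp (- (\<theta> $ j * g $ j) - (\<theta> $ j)\<^sup>2 / 2)) *
    (\<Prod>i\<in>UNIV. exp (lam $ i - mu $ i) * (mu $ i / lam $ i) ^ (n $ i))"
proof -
  have "- (\<theta> \<bullet> g) - (norm \<theta>)\<^sup>2 / 2 = (\<Sum>j\<in>UNIV. - (\<theta> $ j * g $ j) - (\<theta> $ j)\<^sup>2 / 2)"
    unfolding power2_norm_eq_inner
    by (simp add: inner_vec_def sum_subtractf sum_negf sum_divide_distrib power2_eq_square)
  then show ?thesis
    by (simp add: girsanov_weight_def exp_sum)
qed

section \<open>The identity\<close>

theorem lemma1p1:
  fixes M :: "'w measure"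
    and G :: "'w \<Rightarrow> real ^ 'd"
    and mu :: "real ^ 'p"
    and Nmu :: "'w \<Rightarrow> nat ^ 'p"
    and h :: "(real ^ 'd) \<times> (nat ^ 'p) \<Rightarrow> real"
  assumes "prob_space M"
    and "std_normal_vector M G"
    and "\<forall>i. 0 < mu $ i"
    and "poisson_vector_indep M G mu Nmu"
    and "h \<in> borel_measurable (borel \<Otimes>\<^sub>M count_space UNIV)"
  shows "\<forall>\<theta> lam Nlam. (\<forall>i. 0 < lam $ i) \<longrightarrow> poisson_vector_indep M G lam Nlam \<longrightarrow>
      ((\<forall>x. 0 \<le> h x) \<longrightarrow>
         (\<integral>\<^sup>+\<omega>. ennreal (h (G \<omega>, Nmu \<omega>)) \<partial>M) =
         (\<integral>\<^sup>+\<omega>. ennreal (h (G \<omega> + \<theta>, Nlam \<omega>) * girsanov_weight \<theta> mu lam (G \<omega>) (Nlam \<omega>)) \<partial>M)) \<and>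
      (integrable M (\<lambda>\<omega>. h (G \<omega>, Nmu \<omega>)) \<longrightarrow>
         integrable M (\<lambda>\<omega>. h (G \<omega> + \<theta>, Nlam \<omega>) * girsanov_weight \<theta> mu lam (G \<omega>) (Nlam \<omega>)) \<and>
         (\<integral>\<omega>. h (G \<omega>, Nmu \<omega>) \<partial>M) =
         (\<integral>\<omega>. h (G \<omega> + \<theta>, Nlam \<omega>) * girsanov_weight \<theta> mu lam (G \<omega>) (Nlam \<omega>) \<partial>M))"
proof (intro allI impI)
  fix \<theta> lam and Nlam :: "'w \<Rightarrow> nat ^ 'p"
  assume lam: "\<forall>i. 0 < lam $ i" and Nlam: "poisson_vector_indep M G lam Nlam"
  note M = assms(1) and mu = assms(3) and h[measurable] = assms(5)
  let ?S = "borel :: (real ^ 'd) measure" and ?T = "count_space UNIV :: (nat ^ 'p) measure"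
  let ?u = "\<lambda>x :: real ^ 'd. \<Prod>j\<in>UNIV. ennreal (exp (- (\<theta> $ j * x $ j) - (\<theta> $ j)\<^sup>2 / 2))"
  let ?v = "\<lambda>n :: nat ^ 'p.
      \<Prod>i\<in>UNIV. ennreal (exp (lam $ i - mu $ i) * (mu $ i / lam $ i) ^ (n $ i))"
  let ?w = "\<lambda>\<omega>. girsanov_weight \<theta> mu lam (G \<omega>) (Nlam \<omega>)"
  have indep: "indep_rv M ?S G ?T Nmu" "indep_rv M ?S G ?T Nlam"
    and poisson: "poisson_vector M mu Nmu" "poisson_vector M lam Nlam"
    using assms(4) Nlam by (auto simp: poisson_vector_indep_def)
  have [measurable]: "G \<in> borel_measurable M" "Nmu \<in> measurable M ?T" "Nlam \<in> measurable M ?T"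
    using indep by (auto simp: indep_rv_def)
  have nth[measurable]: "(\<lambda>x :: real ^ 'd. x $ j) \<in> borel_measurable borel" for j
    by (rule borel_measurable_nth)
  have [measurable]: "(\<lambda>\<omega>. Nlam \<omega> $ i) \<in> measurable M (count_space UNIV)" for i
    by (rule measurable_compose[of Nlam M ?T]) simp_all
  have w_measurable[measurable]: "?w \<in> borel_measurable M"
    unfolding girsanov_weight_def by measurable
  have w_nonneg: "0 \<le> ?w \<omega>" for \<omega>
    using lam mu by (simp add: girsanov_weight_def prod_nonneg less_imp_le)
  have w: "ennreal (?w \<omega>) = ?u (G \<omega>) * ?v (Nlam \<omega>)" for \<omega>
  proof -
    have pos: "0 \<le> exp (lam $ i - mu $ i) * (mu $ i / lam $ i) ^ k" for i k
      using lam mu by (simp add: less_imp_le)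
    show ?thesis
      unfolding girsanov_weight_eq_prod
      by (simp only: prod_ennreal pos exp_ge_zero ennreal_mult prod_nonneg)
  qed
  have "distr M (?S \<Otimes>\<^sub>M ?T) (\<lambda>\<omega>. (G \<omega>, Nmu \<omega>)) =
      distr (density M (\<lambda>\<omega>. ?u (G \<omega>) * ?v (Nlam \<omega>))) (?S \<Otimes>\<^sub>M ?T) (\<lambda>\<omega>. (G \<omega> + \<theta>, Nlam \<omega>))"
    using M lam mu poisson
    by (intro distr_pair_change_of_measure[OF M indep] std_normal_vector_shift assms
        poisson_vector_change_parameter) simp_all
  then have law: "distr M (?S \<Otimes>\<^sub>M ?T) (\<lambda>\<omega>. (G \<omega>, Nmu \<omega>)) =
      distr (density M (\<lambda>\<omega>. ennreal (?w \<omega>))) (?S \<Otimes>\<^sub>M ?T) (\<lambda>\<omega>. (G \<omega> + \<theta>, Nlam \<omega>))"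
    by (simp only: w)
  have nonneg: "(\<integral>\<^sup>+\<omega>. ennreal (h (G \<omega>, Nmu \<omega>)) \<partial>M) =
      (\<integral>\<^sup>+\<omega>. ennreal (h (G \<omega> + \<theta>, Nlam \<omega>) * ?w \<omega>) \<partial>M)" if "\<forall>x. 0 \<le> h x"
  proof -
    have "(\<integral>\<^sup>+\<omega>. ennreal (h (G \<omega>, Nmu \<omega>)) \<partial>M) =
        (\<integral>\<^sup>+x. ennreal (h x) \<partial>distr M (?S \<Otimes>\<^sub>M ?T) (\<lambda>\<omega>. (G \<omega>, Nmu \<omega>)))"
      by (simp add: nn_integral_distr)
    also have "\<dots> = (\<integral>\<^sup>+\<omega>. ennreal (?w \<omega>) * ennreal (h (G \<omega> + \<theta>, Nlam \<omega>)) \<partial>M)"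
      unfolding law by (simp add: nn_integral_distr nn_integral_density)
    also have "\<dots> = (\<integral>\<^sup>+\<omega>. ennreal (h (G \<omega> + \<theta>, Nlam \<omega>) * ?w \<omega>) \<partial>M)"
      using that w_nonneg by (simp add: ennreal_mult mult.commute)
    finally show ?thesis .
  qed
  have integrable_iff: "integrable M (\<lambda>\<omega>. h (G \<omega>, Nmu \<omega>)) \<longleftrightarrow>
      integrable M (\<lambda>\<omega>. h (G \<omega> + \<theta>, Nlam \<omega>) * ?w \<omega>)"
  proof -
    have "integrable M (\<lambda>\<omega>. h (G \<omega>, Nmu \<omega>)) \<longleftrightarrow>
        integrable (distr M (?S \<Otimes>\<^sub>M ?T) (\<lambda>\<omega>. (G \<omega>, Nmu \<omega>))) h"
      by (simp add: integrable_distr_eq)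
    also have "\<dots> \<longleftrightarrow> integrable M (\<lambda>\<omega>. h (G \<omega> + \<theta>, Nlam \<omega>) * ?w \<omega>)"
      unfolding law
      by (simp add: integrable_distr_eq integrable_density w_nonneg mult.commute)
    finally show ?thesis .
  qed
  have "(\<integral>\<omega>. h (G \<omega>, Nmu \<omega>) \<partial>M) =
      (\<integral>x. h x \<partial>distr M (?S \<Otimes>\<^sub>M ?T) (\<lambda>\<omega>. (G \<omega>, Nmu \<omega>)))"
    by (simp add: integral_distr)
  also have "\<dots> = (\<integral>\<omega>. h (G \<omega> + \<theta>, Nlam \<omega>) * ?w \<omega> \<partial>M)"
    unfolding law
    by (simp add: integral_distr integral_density w_nonneg mult.commute)
  finally show "((\<forall>x. 0 \<le> h x) \<longrightarrow>
         (\<integral>\<^sup>+\<omega>. ennreal (h (G \<omega>, Nmu \<omega>)) \<partial>M) =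
         (\<integral>\<^sup>+\<omega>. ennreal (h (G \<omega> + \<theta>, Nlam \<omega>) * ?w \<omega>) \<partial>M)) \<and>
      (integrable M (\<lambda>\<omega>. h (G \<omega>, Nmu \<omega>)) \<longrightarrow>
         integrable M (\<lambda>\<omega>. h (G \<omega> + \<theta>, Nlam \<omega>) * ?w \<omega>) \<and>
         (\<integral>\<omega>. h (G \<omega>, Nmu \<omega>) \<partial>M) = (\<integral>\<omega>. h (G \<omega> + \<theta>, Nlam \<omega>) * ?w \<omega> \<partial>M))"
    using nonneg integrable_iff by blast
qed

end
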